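(* Let $(A,*,\delta_0)$ be a differential graded associative algebra over a field $\mathbb{K}$ of characteristic zero, and let $d=\delta_0+t\delta_1+t^2\delta_2+\cdots$ be a formal deformation of $\delta_0$. For each $i\ge 1$ let $m_i:(sA)^{\otimes i}\to sA$ be the higher derived product $$m_i:=(-1)^{\frac{(i-1)(i-2)}{2}}\, s\circ M_i\circ (s^{-1}\otimes\cdots\otimes s^{-1})\,(s\delta_{i-1}s^{-1}\otimes 1\otimes\cdots\otimes 1),$$ where $M_i(a_1,\dots,a_i):=a_1*a_2*\cdots*a_i$. Then $(sA,m_1,m_2,\dots)$ is a strong homotopy associative algebra (an $A_\infty$-algebra).
   Context: All spaces are graded vector spaces over $\mathbb{K}$ and $\otimes=\otimes_{\mathbb{K}}$. The Koszul sign convention is used: $(f\otimes g)(v_1\otimes v_2)=(-1)^{|g||v_1|}f(v_1)\otimes g(v_2)$. The operators $s$ and $s^{-1}$ are the degree shifts, of degree $+1$ and $-1$ respectively; they satisfy $s\otimes s=(s\otimes 1)(1\otimes s)=-(1\otimes s)(s\otimes 1)$. The product $*$ has degree $0$, and the differential $\delta_0$ is a square-zero derivation of degree $+1$. Formal deformation: each $\delta_i$ is a derivation of $(A,* )$ of degree $+1$, and $d=\sum_{i\ge0}t^i\delta_i$, regarded as a derivation of $A[[t]]$ ($t$ of degree $0$), satisfies $dd=0$; equivalently $\sum_{i+j=n}\delta_i\delta_j=0$ for all $n\ge 0$. Strong homotopy associative algebra: let $V$ be a graded vector space and $m_i:(sV)^{\otimes i}\to sV$ ($i\ge1$) multilinear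 maps of degree $2-i$. Put $\partial_i:=s^{-1}\circ m_i\circ(s\otimes\cdots\otimes s)\in\mathrm{Hom}(V^{\otimes i},V)$. An $i$-ary map $f:V^{\otimes i}\to V$ is identified with the coderivation $f$ of the tensor (deconcatenation) coalgebra $\bar TV=\bigoplus_{n\ge1}V^{\otimes n}$ that vanishes on $V^{\otimes n}$ for $n<i$ and for $n\ge i$ is $$f(v_1,\dots,v_n)=\sum_{k=0}^{n-i}(-1)^{|f|(|v_1|+\cdots+|v_k|)}(v_1,\dots,v_k,f(v_{k+1},\dots,v_{k+i}),v_{k+i+1},\dots,v_n).$$ The system $(sV,m_1,m_2,\dots)$ is a strong homotopy associative algebra if the coderivation $\partial:=\partial_1+\partial_2+\cdots$ of $\bar TV$ is square zero, i.e. $\tfrac12[\partial,\partial]=\partial\partial=0$. *)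

theory Defs
  imports
    "HOL-Computational_Algebra.Formal_Power_Series"
    "HOL-Library.Poly_Mapping"
begin

section \<open>Graded vector spaces and the Koszul sign convention\<close>

definition signed :: "int \<Rightarrow> 'a::ab_group_add \<Rightarrow> 'a"
  where "signed n a = (if even n then a else - a)"  \<comment> \<open>\<open>(-1)\<^sup>n a\<close>\<close>

definition homogeneous_decomposition ::
    "(int \<Rightarrow> 'a::ab_group_add set) \<Rightarrow> 'a \<Rightarrow> (int \<Rightarrow> 'a) \<Rightarrow> bool"
  where "homogeneous_decomposition G v c \<longleftrightarrow>
    (\<forall>n. c n \<in> G n) \<and> finite {n. c n \<noteq> 0} \<and> v = (\<Sum>n | c n \<noteq> 0. c n)"

locale graded_vector_space = vector_space scale
  for scale :: "'k::field \<Rightarrow> 'a::ab_group_add \<Rightarrow> 'a" +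
  fixes G :: "int \<Rightarrow> 'a set"
  assumes subspace_G: "subspace (G n)"
    and direct_sum: "\<exists>!c. homogeneous_decomposition G v c"

definition component :: "(int \<Rightarrow> 'a::ab_group_add set) \<Rightarrow> 'a \<Rightarrow> int \<Rightarrow> 'a"
  where "component G v = (THE c. homogeneous_decomposition G v c)"

text \<open>
  \<open>koszul G p\<close> is the linear extension to all vectors of \<open>v \<mapsto> (-1)\<^bsup>p |v|\<^esup> v\<close> (\<open>v\<close> homogeneous). It lets
  the signs of the Koszul convention be applied to vectors that are not homogeneous: the sign
  arising when a map of degree \<open>p\<close> moves past \<open>v\<close> is put on the tensor factor \<open>v\<close>.
\<close>

definition koszul :: "(int \<Rightarrow> 'a::ab_group_add set) \<Rightarrow> int \<Rightarrow> 'a \<Rightarrow> 'a"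
  where "koszul G p v = (\<Sum>n | component G v n \<noteq> 0. signed (p * n) (component G v n))"

text \<open>
  \<open>f\<^sub>1 \<otimes> \<dots> \<otimes> f\<^sub>n\<close> evaluated on \<open>v\<^sub>1 \<otimes> \<dots> \<otimes> v\<^sub>n\<close>, where each \<open>f\<^sub>j\<close> is paired with its degree. This iterates
  \<open>(f \<otimes> g)(v \<otimes> w) = (-1)\<^bsup>|g| |v|\<^esup> f(v) \<otimes> g(w)\<close>. Pure tensors are lists of vectors.
\<close>

fun tensor_maps ::
    "(int \<Rightarrow> 'a::ab_group_add set) \<Rightarrow> (('a \<Rightarrow> 'b) \<times> int) list \<Rightarrow> 'a list \<Rightarrow> 'b list"
  where
    "tensor_maps G ((f, p) # fs) (v # vs) =
       f (koszul G (sum_list (map snd fs)) v) # tensor_maps G fs vs"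
  | "tensor_maps G _ _ = []"

text \<open>An \<open>n\<close>-ary multilinear map is a function on lists; only lists of length \<open>n\<close> matter.\<close>

definition multilinear ::
    "('k::field \<Rightarrow> 'a::ab_group_add \<Rightarrow> 'a) \<Rightarrow> ('k \<Rightarrow> 'b::ab_group_add \<Rightarrow> 'b) \<Rightarrow>
     nat \<Rightarrow> ('a list \<Rightarrow> 'b) \<Rightarrow> bool"
  where "multilinear scale1 scale2 n f \<longleftrightarrow>
    (\<forall>us ws. length us + 1 + length ws = n \<longrightarrow>
       Vector_Spaces.linear scale1 scale2 (\<lambda>v. f (us @ v # ws)))"

definition multilinear_of_degree ::
    "('k::field \<Rightarrow> 'a::ab_group_add \<Rightarrow> 'a) \<Rightarrow> (int \<Rightarrow> 'a set) \<Rightarrow>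
     ('k \<Rightarrow> 'b::ab_group_add \<Rightarrow> 'b) \<Rightarrow> (int \<Rightarrow> 'b set) \<Rightarrow>
     nat \<Rightarrow> int \<Rightarrow> ('a list \<Rightarrow> 'b) \<Rightarrow> bool"
  where "multilinear_of_degree scale1 G1 scale2 G2 n p f \<longleftrightarrow>
    multilinear scale1 scale2 n f \<and>
    (\<forall>vs ds. length vs = n \<and> list_all2 (\<lambda>v d. v \<in> G1 d) vs ds \<longrightarrow> f vs \<in> G2 (sum_list ds + p))"

section \<open>Suspension\<close>

text \<open>The constructor \<open>Susp\<close> is \<open>s\<close> and the selector \<open>unsusp\<close> is its inverse.\<close>

datatype 'a susp = Susp (unsusp: 'a)

instantiation susp :: (ab_group_add) ab_group_add
begin

definition zero_susp :: "'a susp" where "0 = Susp 0"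
definition plus_susp :: "'a susp \<Rightarrow> 'a susp \<Rightarrow> 'a susp"
  where "x + y = Susp (unsusp x + unsusp y)"
definition minus_susp :: "'a susp \<Rightarrow> 'a susp \<Rightarrow> 'a susp"
  where "x - y = Susp (unsusp x - unsusp y)"
definition uminus_susp :: "'a susp \<Rightarrow> 'a susp" where "- x = Susp (- unsusp x)"

instance
  by standard
    (simp_all add: zero_susp_def plus_susp_def minus_susp_def uminus_susp_def algebra_simps)

end

definition susp_scale :: "('k \<Rightarrow> 'a \<Rightarrow> 'a) \<Rightarrow> 'k \<Rightarrow> 'a susp \<Rightarrow> 'a susp"
  where "susp_scale scale c x = Susp (scale c (unsusp x))"

definition susp_grading :: "(int \<Rightarrow> 'a set) \<Rightarrow> int \<Rightarrow> 'a susp set"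
  where "susp_grading G n = Susp ` G (n - 1)"

section \<open>The tensor space\<close>

text \<open>
  The tensor space \<open>TV\<close> is the free vector space on words in \<open>V\<close> modulo the multilinearity relations;
  the class of the word \<open>[v\<^sub>1, \<dots>, v\<^sub>n]\<close> is \<open>v\<^sub>1 \<otimes> \<dots> \<otimes> v\<^sub>n\<close>.
\<close>

type_synonym ('a, 'k) words = "'a list \<Rightarrow>\<^sub>0 'k"

definition word :: "'a list \<Rightarrow> ('a, 'k::field) words"
  where "word vs = Poly_Mapping.single vs 1"

definition words_scale :: "'k::field \<Rightarrow> ('a, 'k) words \<Rightarrow> ('a, 'k) words"
  where "words_scale c x = Poly_Mapping.map ((*) c) x"

definition linear_extension ::
    "('a list \<Rightarrow> ('b, 'k) words) \<Rightarrow> ('a, 'k::field) words \<Rightarrow> ('b, 'k) words"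
  where "linear_extension f x =
    (\<Sum>w\<in>Poly_Mapping.keys x. words_scale (Poly_Mapping.lookup x w) (f w))"

definition tensor_relations ::
    "('k::field \<Rightarrow> 'a::ab_group_add \<Rightarrow> 'a) \<Rightarrow> ('a, 'k) words set"
  where "tensor_relations scale = module.span words_scale
    ({word (us @ (a + b) # ws) - word (us @ a # ws) - word (us @ b # ws) | us a b ws. True} \<union>
     {word (us @ scale c a # ws) - words_scale c (word (us @ a # ws)) | us c a ws. True})"

definition tensor_eq ::
    "('k::field \<Rightarrow> 'a::ab_group_add \<Rightarrow> 'a) \<Rightarrow> (('a, 'k) words \<times> ('a, 'k) words) set"
  where "tensor_eq scale = {(x, y). x - y \<in> tensor_relations scale}"

definition tensor_class ::
    "('k::field \<Rightarrow> 'a::ab_group_add \<Rightarrow> 'a) \<Rightarrow> ('a, 'k) words \<Rightarrow> ('a, 'k) words set"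
  where "tensor_class scale x = tensor_eq scale `` {x}"

text \<open>The reduced tensor space: the direct sum of the tensor powers of positive length.\<close>

definition reduced_tensor_space ::
    "('k::field \<Rightarrow> 'a::ab_group_add \<Rightarrow> 'a) \<Rightarrow> ('a, 'k) words set set"
  where "reduced_tensor_space scale = tensor_class scale ` {x. [] \<notin> Poly_Mapping.keys x}"

text \<open>
  The map on tensor classes induced by a map on words. It is meaningful if the linear extension
  respects the multilinearity relations, as it does for \<open>coderivation\<close> of a multilinear map.
\<close>

definition induced_map ::
    "('k::field \<Rightarrow> 'a::ab_group_add \<Rightarrow> 'a) \<Rightarrow> ('a list \<Rightarrow> ('a, 'k) words) \<Rightarrow>
     ('a, 'k) words set \<Rightarrow> ('a, 'k) words set"
  where "induced_map scale f X = (\<Union>x\<in>X. tensor_class scale (linear_extension f x))"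

section \<open>Strong homotopy associative algebras\<close>

text \<open>The coderivation determined by an \<open>i\<close>-ary map \<open>f\<close> of degree \<open>p\<close>, evaluated on a word.\<close>

definition coderivation ::
    "(int \<Rightarrow> 'a::ab_group_add set) \<Rightarrow> int \<Rightarrow> nat \<Rightarrow> ('a list \<Rightarrow> 'a) \<Rightarrow> 'a list \<Rightarrow> ('a, 'k::field) words"
  where "coderivation G p i f vs =
    (if length vs < i then 0
     else \<Sum>k = 0..length vs - i.
       word (map (koszul G p) (take k vs) @ f (take i (drop k vs)) # drop (k + i) vs))"

definition desuspension ::
    "(int \<Rightarrow> 'a::ab_group_add set) \<Rightarrow> (nat \<Rightarrow> 'a susp list \<Rightarrow> 'a susp) \<Rightarrow> nat \<Rightarrow> 'a list \<Rightarrow> 'a"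
  where "desuspension G m i = unsusp \<circ> m i \<circ> tensor_maps G (replicate i (Susp, 1))"

text \<open>
  If \<open>m\<^sub>i\<close> has degree \<open>2 - i\<close>, its desuspension has degree \<open>(2 - i) + i - 1 = 1\<close>. The sum over all
  \<open>i \<ge> 1\<close> stops at the length of the word, since the later coderivations vanish on it.
\<close>

definition total_coderivation ::
    "(int \<Rightarrow> 'a::ab_group_add set) \<Rightarrow> (nat \<Rightarrow> 'a susp list \<Rightarrow> 'a susp) \<Rightarrow>
     'a list \<Rightarrow> ('a, 'k::field) words"
  where "total_coderivation G m vs =
    (\<Sum>i = 1..length vs. coderivation G 1 i (desuspension G m i) vs)"

definition sh_associative_algebra ::
    "('k::field \<Rightarrow> 'a::ab_group_add \<Rightarrow> 'a) \<Rightarrow> (int \<Rightarrow> 'a set) \<Rightarrow>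
     (nat \<Rightarrow> 'a susp list \<Rightarrow> 'a susp) \<Rightarrow> bool"
  where "sh_associative_algebra scale G m \<longleftrightarrow>
    graded_vector_space scale G \<and>
    (\<forall>i\<ge>1. multilinear_of_degree (susp_scale scale) (susp_grading G)
             (susp_scale scale) (susp_grading G) i (2 - int i) (m i)) \<and>
    (\<forall>X\<in>reduced_tensor_space scale.
       induced_map scale (total_coderivation G m) (induced_map scale (total_coderivation G m) X)
         = tensor_class scale 0)"

section \<open>Differential graded algebras and formal deformations\<close>

text \<open>Class \<open>ring\<close> is the class of associative rings, with or without unit.\<close>

locale graded_algebra = graded_vector_space scale G
  for scale :: "'k::field \<Rightarrow> 'a::ring \<Rightarrow> 'a" and G :: "int \<Rightarrow> 'a set" +
  assumes scale_mult_left: "scale c a * b = scale c (a * b)"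
    and scale_mult_right: "a * scale c b = scale c (a * b)"
    and mult_degree: "a \<in> G p \<Longrightarrow> b \<in> G q \<Longrightarrow> a * b \<in> G (p + q)"

definition derivation_of_degree ::
    "('k::field \<Rightarrow> 'a::ring \<Rightarrow> 'a) \<Rightarrow> (int \<Rightarrow> 'a set) \<Rightarrow> int \<Rightarrow> ('a \<Rightarrow> 'a) \<Rightarrow> bool"
  where "derivation_of_degree scale G r D \<longleftrightarrow>
    Vector_Spaces.linear scale scale D \<and>
    (\<forall>p. D ` G p \<subseteq> G (p + r)) \<and>
    (\<forall>p a b. a \<in> G p \<longrightarrow> D (a * b) = D a * b + signed (r * p) (a * D b))"

definition dg_algebra ::
    "('k::field \<Rightarrow> 'a::ring \<Rightarrow> 'a) \<Rightarrow> (int \<Rightarrow> 'a set) \<Rightarrow> ('a \<Rightarrow> 'a) \<Rightarrow> bool"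
  where "dg_algebra scale G D \<longleftrightarrow>
    graded_algebra scale G \<and> derivation_of_degree scale G 1 D \<and> (\<forall>a. D (D a) = 0)"

text \<open>The map \<open>\<delta>\<^sub>0 + t \<delta>\<^sub>1 + t\<^sup>2 \<delta>\<^sub>2 + \<dots>\<close> on formal power series, extended \<open>t\<close>-linearly.\<close>

definition series_map :: "(nat \<Rightarrow> 'a \<Rightarrow> 'a) \<Rightarrow> 'a::ring fps \<Rightarrow> 'a fps"
  where "series_map \<delta> x = Abs_fps (\<lambda>n. \<Sum>i\<le>n. \<delta> i (fps_nth x (n - i)))"

definition formal_deformation ::
    "('k::field \<Rightarrow> 'a::ring \<Rightarrow> 'a) \<Rightarrow> (int \<Rightarrow> 'a set) \<Rightarrow> ('a \<Rightarrow> 'a) \<Rightarrow> (nat \<Rightarrow> 'a \<Rightarrow> 'a) \<Rightarrow> bool"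
  where "formal_deformation scale G D \<delta> \<longleftrightarrow>
    \<delta> 0 = D \<and> (\<forall>i. derivation_of_degree scale G 1 (\<delta> i)) \<and>
    (\<forall>x. series_map \<delta> (series_map \<delta> x) = 0)"

section \<open>Higher derived products\<close>

fun iterated_product :: "'a::ring list \<Rightarrow> 'a"
  where
    "iterated_product (a # as) = foldl (*) a as"
  | "iterated_product [] = 0"  \<comment> \<open>junk value\<close>

definition higher_derived_product ::
    "(int \<Rightarrow> 'a::ring set) \<Rightarrow> (nat \<Rightarrow> 'a \<Rightarrow> 'a) \<Rightarrow> nat \<Rightarrow> 'a susp list \<Rightarrow> 'a susp"
  where "higher_derived_product G \<delta> i xs =
    signed (((int i - 1) * (int i - 2)) div 2)
      ((Susp \<circ> iterated_product
         \<circ> tensor_maps (susp_grading G) (replicate i (unsusp, -1))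
         \<circ> tensor_maps (susp_grading G)
             ((Susp \<circ> \<delta> (i - 1) \<circ> unsusp, 1) # replicate (i - 1) (id, 0))) xs)"

end

theory Submission imports Defs begin

text \<open>
  All signs in the desuspension cancel: \<open>\<partial>\<^sub>i (v\<^sub>1, \<dots>, v\<^sub>i) = \<delta>\<^sub>i\<^sub>-\<^sub>1 v\<^sub>1 * v\<^sub>2 * \<dots> * v\<^sub>i\<close>. In \<open>\<partial>\<partial>\<close>, operations at
  disjoint places cancel because \<open>\<partial>\<close> is odd. When the outer operation \<open>\<delta>\<^sub>l\<close> is applied to a product
  \<open>\<delta>\<^sub>k v\<^sub>1 * v\<^sub>2 * \<dots>\<close>, the Leibniz terms in which it hits some \<open>v\<^sub>j\<close> with \<open>j > 1\<close> cancel against the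
  terms where \<open>\<delta>\<^sub>l v\<^sub>j * \<dots>\<close> is formed first; what remains is \<open>\<Sum> \<delta>\<^sub>l \<delta>\<^sub>k v\<^sub>1 * v\<^sub>2 * \<dots>\<close>, which vanishes since
  \<open>d d = 0\<close>. To avoid calculating modulo the multilinearity relations, the argument is carried
  out on the dual side, for functions on words that are linear in each letter.
\<close>

section \<open>Signs, homogeneous components and the Koszul sign operator\<close>

lemma signed_simps [simp]:
  "signed n 0 = 0"
  "signed 0 a = a"
  "signed n (signed m a) = signed (n + m) a"
  by (auto simp: signed_def)

lemma signed_add: "signed n (a + b) = signed n a + signed n b"
  by (simp add: signed_def)

lemma signed_even: "even n \<Longrightarrow> signed n a = a"
  by (simp add: signed_def)

lemma signed_mult_left: "signed n a * b = signed n (a * b)" for a b :: "'a::ring"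
  by (simp add: signed_def)

lemma signed_mult_right: "a * signed n b = signed n (a * b)" for a b :: "'a::ring"
  by (simp add: signed_def)

context graded_vector_space
begin

lemma zero_in_G [simp]: "0 \<in> G n"
  by (rule subspace_0[OF subspace_G])

lemma signed_in_G: "v \<in> G n \<Longrightarrow> signed m v \<in> G n"
  by (simp add: signed_def subspace_neg[OF subspace_G])

lemma signed_scale: "signed n (scale c v) = scale c (signed n v)"
  by (simp add: signed_def)

lemma component_decomposition: "homogeneous_decomposition G v (component G v)"
  unfolding component_def by (rule theI'[OF direct_sum])

lemma component_eqI: "homogeneous_decomposition G v c \<Longrightarrow> component G v = c"
  using direct_sum[of v] component_decomposition[of v] by blast

lemma finite_component: "finite {n. component G v n \<noteq> 0}"
  using component_decomposition[of v] by (simp add: homogeneous_decomposition_def)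

lemma component_in_G: "component G v n \<in> G n"
  using component_decomposition[of v] by (simp add: homogeneous_decomposition_def)

lemma sum_component: "v = (\<Sum>n | component G v n \<noteq> 0. component G v n)"
  using component_decomposition[of v] by (simp add: homogeneous_decomposition_def)

text \<open>Padding with zero components lets two vectors share one index set, as the additivity
  proofs require.\<close>

lemma sum_component_superset:
  assumes "finite S" "{n. component G v n \<noteq> 0} \<subseteq> S"
  shows "(\<Sum>n\<in>S. component G v n) = v"
proof -
  have "(\<Sum>n\<in>S. component G v n) = (\<Sum>n | component G v n \<noteq> 0. component G v n)"
    by (rule sum.mono_neutral_right) (use assms in auto)
  then show ?thesis using sum_component[of v] by simp
qed

lemma koszul_superset:
  assumes "finite S" "{n. component G v n \<noteq> 0} \<subseteq> S"
  shows "koszul G p v = (\<Sum>n\<in>S. signed (p * n) (component G v n))"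
  unfolding koszul_def by (rule sum.mono_neutral_left) (use assms in auto)

lemma component_add: "component G (u + v) = (\<lambda>n. component G u n + component G v n)"
proof (rule component_eqI)
  let ?c = "\<lambda>n. component G u n + component G v n"
  let ?S = "{n. component G u n \<noteq> 0} \<union> {n. component G v n \<noteq> 0}"
  have fin: "finite ?S" by (simp add: finite_component)
  have sub: "{n. ?c n \<noteq> 0} \<subseteq> ?S" by auto
  have "u + v = (\<Sum>n\<in>?S. ?c n)"
    by (subst sum.distrib) (simp add: sum_component_superset fin[simplified])
  also have "\<dots> = (\<Sum>n | ?c n \<noteq> 0. ?c n)"
    by (rule sum.mono_neutral_right) (use fin sub in auto)
  finally show "homogeneous_decomposition G (u + v) ?c"
    unfolding homogeneous_decomposition_def
    using component_in_G subspace_add[OF subspace_G] finite_subset[OF sub fin] by blast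
qed

lemma component_scale: "component G (scale c v) = (\<lambda>n. scale c (component G v n))"
\<comment> \<open>Only a nonzero scalar preserves the support of the components; for
  \<open>c = 0\<close> it collapses to the empty set.\<close>
proof (cases "c = 0")
  case True
  then show ?thesis
    by (intro component_eqI) (simp add: homogeneous_decomposition_def)
next
  case False
  have "scale c v = scale c (\<Sum>n | component G v n \<noteq> 0. component G v n)"
    using sum_component[of v] by simp
  also have "\<dots> = (\<Sum>n | component G v n \<noteq> 0. scale c (component G v n))"
    by (rule scale_sum_right)
  finally show ?thesis
    using False component_in_G subspace_scale[OF subspace_G] finite_component
    by (intro component_eqI) (simp add: homogeneous_decomposition_def)
qed

lemma component_homogeneous: "v \<in> G d \<Longrightarrow> component G v = (\<lambda>n. if n = d then v else 0)"
proof (rule component_eqI)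
  assume "v \<in> G d"
  moreover have "{n. (if n = d then v else 0) \<noteq> 0} = (if v = 0 then {} else {d})" by auto
  ultimately show "homogeneous_decomposition G v (\<lambda>n. if n = d then v else 0)"
    by (simp add: homogeneous_decomposition_def)
qed

lemma koszul_homogeneous: "v \<in> G d \<Longrightarrow> koszul G p v = signed (p * d) v"
  by (subst koszul_superset[of "{d}"]) (auto simp: component_homogeneous)

lemma koszul_add: "koszul G p (u + v) = koszul G p u + koszul G p v"
proof -
  let ?S = "{n. component G u n \<noteq> 0} \<union> {n. component G v n \<noteq> 0}"
  have fin: "finite ?S" by (simp add: finite_component)
  have "koszul G p (u + v) = (\<Sum>n\<in>?S. signed (p * n) (component G (u + v) n))"
    by (rule koszul_superset[OF fin]) (auto simp: component_add)
  also have "\<dots> = (\<Sum>n\<in>?S. signed (p * n) (component G u n)) + (\<Sum>n\<in>?S. signed (p * n) (component G v n))"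
    by (simp add: component_add signed_add sum.distrib)
  also have "\<dots> = koszul G p u + koszul G p v"
    by (simp add: koszul_superset[OF fin])
  finally show ?thesis .
qed

lemma koszul_scale: "koszul G p (scale c v) = scale c (koszul G p v)"
proof -
  have "koszul G p (scale c v) = (\<Sum>n | component G v n \<noteq> 0. signed (p * n) (component G (scale c v) n))"
    by (rule koszul_superset[OF finite_component]) (auto simp: component_scale)
  then show ?thesis
    by (simp add: component_scale signed_scale koszul_def scale_sum_right)
qed

text \<open>Every vector is a finite sum of its components. Identities that are additive in a vector
  thus reduce to the homogeneous case, where \<open>koszul\<close> is a plain sign.\<close>

lemma homogeneous_induct [case_names homogeneous add]:
  assumes hom: "\<And>d v. v \<in> G d \<Longrightarrow> P v"
    and add: "\<And>u v. P u \<Longrightarrow> P v \<Longrightarrow> P (u + v)"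
  shows "P v"
proof -
  have "P (\<Sum>n\<in>S. component G v n)" if "finite S" for S
    using that by induction (simp_all add: hom[OF zero_in_G] add hom[OF component_in_G])
  then show ?thesis using finite_component sum_component by metis
qed

lemma koszul_even: "even p \<Longrightarrow> koszul G p v = v"
  by (induction v rule: homogeneous_induct) (simp_all add: koszul_homogeneous koszul_add signed_even)

lemma koszul_koszul: "koszul G p (koszul G q v) = koszul G (p + q) v"
  by (induction v rule: homogeneous_induct)
    (simp_all add: koszul_homogeneous[OF signed_in_G] koszul_homogeneous koszul_add distrib_right)

lemma koszul_in_G: "v \<in> G d \<Longrightarrow> koszul G p v \<in> G d"
  by (simp add: koszul_homogeneous signed_in_G)

end

section \<open>Suspension of a graded vector space\<close>

lemma unsusp_simps [simp]:
  "unsusp 0 = 0" "unsusp (x + y) = unsusp x + unsusp y" "unsusp (- x) = - unsusp x"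
  "unsusp (susp_scale scale c x) = scale c (unsusp x)"
  by (simp_all add: zero_susp_def plus_susp_def uminus_susp_def susp_scale_def)

lemma unsusp_eq_0_iff: "unsusp x = 0 \<longleftrightarrow> x = 0"
  by (cases x) (simp add: zero_susp_def)

lemma unsusp_sum: "unsusp (sum f S) = (\<Sum>x\<in>S. unsusp (f x))"
  by (induction S rule: infinite_finite_induct) simp_all

lemma unsusp_signed [simp]: "unsusp (signed n x) = signed n (unsusp x)"
  by (simp add: signed_def)

lemma in_susp_grading_iff: "x \<in> susp_grading G n \<longleftrightarrow> unsusp x \<in> G (n - 1)"
  by (cases x) (auto simp: susp_grading_def)

lemma vector_space_susp: "vector_space scale \<Longrightarrow> vector_space (susp_scale scale)"
  by (simp add: vector_space_def susp.expand)

text \<open>Suspension raises degrees by one, so decompositions correspond after a shift of the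
  index; this carries the direct sum property over to the suspension.\<close>

lemma homogeneous_decomposition_susp:
  "homogeneous_decomposition (susp_grading G) x c \<longleftrightarrow>
   homogeneous_decomposition G (unsusp x) (\<lambda>n. unsusp (c (n + 1)))"
proof -
  have inj: "inj_on (\<lambda>n::int. n + 1) A" for A by simp
  have img: "{n. c n \<noteq> 0} = (\<lambda>n. n + 1) ` {n. c (n + 1) \<noteq> 0}"
    by (auto simp: image_iff) (metis diff_add_cancel)
  have "finite {n. c n \<noteq> 0} \<longleftrightarrow> finite {n. c (n + 1) \<noteq> 0}"
    unfolding img by (rule finite_image_iff[OF inj])
  moreover have "(\<Sum>n | c n \<noteq> 0. c n) = (\<Sum>n | c (n + 1) \<noteq> 0. c (n + 1))"
    unfolding img by (subst sum.reindex[OF inj]) simp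
  moreover have "(\<forall>n. c n \<in> susp_grading G n) \<longleftrightarrow> (\<forall>n. unsusp (c (n + 1)) \<in> G n)"
    unfolding in_susp_grading_iff by (metis diff_add_cancel add_diff_cancel_right')
  moreover have "x = y \<longleftrightarrow> unsusp x = unsusp y" for y
    by (auto intro: susp.expand)
  ultimately show ?thesis
    by (simp add: homogeneous_decomposition_def unsusp_eq_0_iff unsusp_sum)
qed

lemma graded_vector_space_susp:
  fixes scale :: "'k::field \<Rightarrow> 'a::ab_group_add \<Rightarrow> 'a"
  assumes "graded_vector_space scale G"
  shows "graded_vector_space (susp_scale scale) (susp_grading G)"
proof -
  interpret graded_vector_space scale G by fact
  interpret S: vector_space "susp_scale scale" by (rule vector_space_susp) unfold_locales
  show ?thesis
  proof
    show "S.subspace (susp_grading G n)" for n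
      using subspace_G[of "n - 1"]
      by (simp add: S.subspace_def subspace_def in_susp_grading_iff)
    fix x :: "'a susp"
    obtain c where c: "homogeneous_decomposition G (unsusp x) c"
      using direct_sum by blast
    show "\<exists>!c. homogeneous_decomposition (susp_grading G) x c"
    proof
      show "homogeneous_decomposition (susp_grading G) x (\<lambda>n. Susp (c (n - 1)))"
        using c by (simp add: homogeneous_decomposition_susp)
      fix b assume "homogeneous_decomposition (susp_grading G) x b"
      then have "homogeneous_decomposition G (unsusp x) (\<lambda>n. unsusp (b (n + 1)))"
        by (simp add: homogeneous_decomposition_susp)
      then have "(\<lambda>n. unsusp (b (n + 1))) = c"
        using c direct_sum by blast
      then have "unsusp (b n) = c (n - 1)" for n by (auto dest: fun_cong[of _ _ "n - 1"])
      then show "b = (\<lambda>n. Susp (c (n - 1)))"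
        by (metis susp.collapse)
    qed
  qed
qed

text \<open>The factor \<open>signed p\<close> reflects that a suspended vector has degree one more
  than the vector itself.\<close>

lemma koszul_susp:
  assumes "graded_vector_space scale G"
  shows "unsusp (koszul (susp_grading G) p x) = signed p (koszul G p (unsusp x))"
proof -
  interpret graded_vector_space scale G by fact
  interpret S: graded_vector_space "susp_scale scale" "susp_grading G"
    by (rule graded_vector_space_susp) fact
  show ?thesis
  proof (induction x rule: S.homogeneous_induct)
    case (homogeneous d x)
    then have "unsusp x \<in> G (d - 1)" by (simp add: in_susp_grading_iff)
    then show ?case using homogeneous
      by (simp add: S.koszul_homogeneous koszul_homogeneous algebra_simps)
  qed (simp_all add: S.koszul_add koszul_add signed_add)
qed

section \<open>Koszul signs and derivations in a graded algebra\<close>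

context graded_algebra
begin

text \<open>Degrees add under the product, so the sign \<open>(-1)^(p |a|)\<close> is
  multiplicative.\<close>

lemma koszul_mult: "koszul G p (a * b) = koszul G p a * koszul G p b"
proof (induction a rule: homogeneous_induct)
  case (homogeneous d a)
  then show ?case
    by (induction b rule: homogeneous_induct)
      (simp_all add: koszul_homogeneous mult_degree koszul_homogeneous[OF mult_degree] koszul_add
        signed_mult_left signed_mult_right distrib_left add.commute)
qed (simp add: koszul_add distrib_right)

end

text \<open>The assumption \<open>square_zero\<close> is the coefficient of \<open>t^n\<close> in
  \<open>d d a = 0\<close> for a constant series \<open>a\<close>.\<close>

locale deformed_algebra = graded_algebra scale G
  for scale :: "'k::field \<Rightarrow> 'a::ring \<Rightarrow> 'a" and G :: "int \<Rightarrow> 'a set" +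
  fixes \<delta> :: "nat \<Rightarrow> 'a \<Rightarrow> 'a"
  assumes derivation: "derivation_of_degree scale G 1 (\<delta> i)"
    and square_zero: "(\<Sum>i\<le>n. \<delta> i (\<delta> (n - i) a)) = 0"
begin

lemma derivation_add: "\<delta> i (a + b) = \<delta> i a + \<delta> i b"
  and derivation_scale: "\<delta> i (scale c a) = scale c (\<delta> i a)"
  and derivation_in_G: "a \<in> G p \<Longrightarrow> \<delta> i a \<in> G (p + 1)"
  using derivation[of i] by (auto simp: derivation_of_degree_def Vector_Spaces.linear_iff image_subset_iff)

lemma derivation_signed: "\<delta> i (signed n a) = signed n (\<delta> i a)"
  using derivation_scale[of i "- 1" a] by (simp add: signed_def)

text \<open>The Leibniz sign is absorbed into \<open>koszul G 1 a\<close>; both sides are then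
  additive in \<open>a\<close>, which need no longer be homogeneous.\<close>

lemma derivation_mult: "\<delta> i (a * b) = \<delta> i a * b + koszul G 1 a * \<delta> i b"
proof (induction a rule: homogeneous_induct)
  case (homogeneous d a)
  then show ?case using derivation[of i]
    by (simp add: derivation_of_degree_def koszul_homogeneous signed_mult_left)
qed (simp add: koszul_add derivation_add distrib_right)

text \<open>The map \<open>\<delta> i\<close> raises the degree by one, so the signs read off before
  and after it differ by \<open>(-1)^p\<close>.\<close>

lemma koszul_derivation: "koszul G p (\<delta> i a) = signed p (\<delta> i (koszul G p a))"
proof (induction a rule: homogeneous_induct)
  case (homogeneous d a)
  then show ?case
    by (simp add: koszul_homogeneous[OF derivation_in_G] koszul_homogeneous derivation_signed
        distrib_left add.commute)
qed (simp add: koszul_add derivation_add signed_add)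

end

section \<open>Functions on words that are linear in each letter, and the transposed
  coderivation\<close>

definition slotwise_linear ::
    "('k \<Rightarrow> 'a::ab_group_add \<Rightarrow> 'a) \<Rightarrow> ('k \<Rightarrow> 'w::ab_group_add \<Rightarrow> 'w) \<Rightarrow> ('a list \<Rightarrow> 'w) \<Rightarrow> bool"
  where "slotwise_linear scale scaleW h \<longleftrightarrow>
    (\<forall>us a b ws. h (us @ (a + b) # ws) = h (us @ a # ws) + h (us @ b # ws)) \<and>
    (\<forall>us c a ws. h (us @ scale c a # ws) = scaleW c (h (us @ a # ws)))"

lemma slotwise_linear_Cons:
  assumes "slotwise_linear scale scaleW h"
  shows "slotwise_linear scale scaleW (\<lambda>ws. h (v # ws))"
  using assms unfolding slotwise_linear_def by (metis append_Cons)

lemma slotwise_linear_head: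
  assumes "slotwise_linear scale scaleW h"
  shows "h ((a + b) # ws) = h (a # ws) + h (b # ws)" "h (scale c a # ws) = scaleW c (h (a # ws))"
  using assms unfolding slotwise_linear_def by (metis append_Nil)+

text \<open>
  A function \<open>h\<close> on words is pulled back along \<open>a v\<^sub>1 \<dots> v\<^sub>n \<mapsto> (a * v\<^sub>1 * \<dots> * v\<^sub>k) v\<^sub>k\<^sub>+\<^sub>1 \<dots> v\<^sub>n\<close>.
\<close>

fun contract :: "nat \<Rightarrow> ('a::ring list \<Rightarrow> 'w::zero) \<Rightarrow> 'a \<Rightarrow> 'a list \<Rightarrow> 'w"
  where
    "contract 0 h a vs = h (a # vs)"
  | "contract (Suc k) h a (w # vs) = contract k h (a * w) vs"
  | "contract (Suc k) h a [] = 0"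

text \<open>Words with fewer than \<open>k\<close> letters give 0. Sums of contractions may
  therefore run past the length of the word, which later proofs use to align ranges.\<close>

lemma contract_eq:
  "contract k h a vs = (if k \<le> length vs then h (foldl (*) a (take k vs) # drop k vs) else 0)"
  by (induction k h a vs rule: contract.induct) simp_all

text \<open>By associativity two nested products form one. The letter \<open>b\<close> is itself one
  of the \<open>Suc k\<close> factors taken by the inner contraction, hence
  \<open>k + l\<close>.\<close>

lemma contract_contract:
  "contract l (contract (Suc k) h a) b vs = contract (k + l) h (a * b) vs"
proof (induction l arbitrary: b vs)
  case (Suc l)
  then show ?case by (cases vs) (simp_all add: mult.assoc)
qed simp

text \<open>
  The transpose, acting on functions on words, of the coderivation determined by the maps
  \<open>(v\<^sub>1, \<dots>, v\<^sub>i) \<mapsto> \<delta>\<^sub>i\<^sub>-\<^sub>1 v\<^sub>1 * v\<^sub>2 * \<dots> * v\<^sub>i\<close>.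
\<close>

fun transpose_coderivation ::
    "(int \<Rightarrow> 'a::ring set) \<Rightarrow> (nat \<Rightarrow> 'a \<Rightarrow> 'a) \<Rightarrow> ('a list \<Rightarrow> 'w::ab_group_add) \<Rightarrow> 'a list \<Rightarrow> 'w"
  where
    "transpose_coderivation G \<delta> h [] = 0"
  | "transpose_coderivation G \<delta> h (v # vs) =
       (\<Sum>k\<le>length vs. contract k h (\<delta> k v) vs)
       + transpose_coderivation G \<delta> (\<lambda>ws. h (koszul G 1 v # ws)) vs"

text \<open>Contractions never lengthen a word, so \<open>h\<close> is evaluated only on words at
  most as long as \<open>vs\<close>.\<close>

lemma transpose_coderivation_cong:
  assumes "\<And>ws. length ws \<le> length vs \<Longrightarrow> h ws = h' ws"
  shows "transpose_coderivation G \<delta> h vs = transpose_coderivation G \<delta> h' vs"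
  using assms
proof (induction vs arbitrary: h h')
  case (Cons v vs)
  have "transpose_coderivation G \<delta> (\<lambda>ws. h (koszul G 1 v # ws)) vs
      = transpose_coderivation G \<delta> (\<lambda>ws. h' (koszul G 1 v # ws)) vs"
    by (rule Cons.IH) (simp add: Cons.prems)
  then show ?case
    by (simp add: contract_eq Cons.prems)
qed simp

lemma contract_fun_add: "contract k (\<lambda>ws. h ws + h' ws) a vs = contract k h a vs + contract k h' a vs"
  for h :: "'a::ring list \<Rightarrow> 'w::ab_group_add"
  by (simp add: contract_eq)

lemma transpose_coderivation_fun_add:
  "transpose_coderivation G \<delta> (\<lambda>ws. h ws + h' ws) vs
   = transpose_coderivation G \<delta> h vs + transpose_coderivation G \<delta> h' vs"
  by (induction vs arbitrary: h h') (simp_all add: contract_fun_add sum.distrib)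

lemma transpose_coderivation_fun_zero: "transpose_coderivation G \<delta> (\<lambda>ws. 0) vs = 0"
  using transpose_coderivation_fun_add[of G \<delta> "\<lambda>ws. 0" "\<lambda>ws. 0" vs] by simp

lemma transpose_coderivation_fun_uminus:
  "transpose_coderivation G \<delta> (\<lambda>ws. - h ws) vs = - transpose_coderivation G \<delta> h vs"
  using transpose_coderivation_fun_add[of G \<delta> h "\<lambda>ws. - h ws" vs]
  by (simp add: transpose_coderivation_fun_zero eq_neg_iff_add_eq_0 add.commute)

lemma transpose_coderivation_fun_sum:
  "transpose_coderivation G \<delta> (\<lambda>ws. \<Sum>i\<in>S. h i ws) vs
   = (\<Sum>i\<in>S. transpose_coderivation G \<delta> (h i) vs)"
  by (induction S rule: infinite_finite_induct)
    (simp_all add: transpose_coderivation_fun_zero transpose_coderivation_fun_add)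

context deformed_algebra
begin

context
  fixes scaleW :: "'k \<Rightarrow> 'w::ab_group_add \<Rightarrow> 'w"
  assumes W: "vector_space scaleW"
begin

interpretation W: vector_space scaleW by (fact W)

lemma contract_fun_scale: "contract k (\<lambda>ws. scaleW c (h ws)) a vs = scaleW c (contract k h a vs)"
  by (simp add: contract_eq)

lemma transpose_coderivation_fun_scale:
  "transpose_coderivation G \<delta> (\<lambda>ws. scaleW c (h ws)) vs = scaleW c (transpose_coderivation G \<delta> h vs)"
  by (induction vs arbitrary: h)
    (simp_all add: contract_fun_scale W.scale_right_distrib W.scale_sum_right)

context
  fixes h :: "'a list \<Rightarrow> 'w"
  assumes h: "slotwise_linear scale scaleW h"
begin

lemma contract_add: "contract k h (a + b) vs = contract k h a vs + contract k h b vs"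
proof (induction k arbitrary: a b vs)
  case (Suc k)
  then show ?case by (cases vs) (simp_all add: distrib_right)
qed (simp add: slotwise_linear_head[OF h])

lemma contract_scale: "contract k h (scale c a) vs = scaleW c (contract k h a vs)"
proof (induction k arbitrary: a vs)
  case (Suc k)
  then show ?case by (cases vs) (simp_all add: scale_mult_left)
qed (simp add: slotwise_linear_head[OF h])

lemma contract_zero: "contract k h 0 vs = 0"
  using contract_add[of k 0 0 vs] by simp

lemma contract_uminus: "contract k h (- a) vs = - contract k h a vs"
  using contract_add[of k a "- a" vs] by (simp add: contract_zero eq_neg_iff_add_eq_0 add.commute)

lemma contract_sum: "contract k h (\<Sum>i\<in>S. f i) vs = (\<Sum>i\<in>S. contract k h (f i) vs)"
  by (induction S rule: infinite_finite_induct) (simp_all add: contract_zero contract_add)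

end

text \<open>A letter is either multiplied into the leading factor, where bilinearity of the product
  and linearity of \<open>h\<close> in its first slot apply, or passed on to \<open>h\<close>
  unchanged.\<close>

lemma slotwise_linear_contract:
  assumes h: "slotwise_linear scale scaleW h"
  shows "slotwise_linear scale scaleW (contract k h a)"
proof -
  have "contract k h a (us @ (v + w) # ws) = contract k h a (us @ v # ws) + contract k h a (us @ w # ws)
     \<and> contract k h a (us @ scale c v # ws) = scaleW c (contract k h a (us @ v # ws))" for us v w ws c
  proof (induction us arbitrary: k a)
    case Nil
    then show ?case
      using slotwise_linear_head[OF slotwise_linear_Cons[OF h, of a]]
      by (cases k) (simp_all add: distrib_left scale_mult_right
          contract_add[OF h] contract_scale[OF h])
  next
    case (Cons u us)
    then show ?case
      using slotwise_linear_Cons[OF h, of a, unfolded slotwise_linear_def]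
      by (cases k) (simp_all, metis append_Cons)
  qed
  then show ?thesis by (simp add: slotwise_linear_def)
qed

text \<open>This is the dual form of the fact that the coderivation respects the multilinearity
  relations.\<close>

lemma slotwise_linear_transpose_coderivation:
  assumes "slotwise_linear scale scaleW h"
  shows "slotwise_linear scale scaleW (transpose_coderivation G \<delta> h)"
proof -
  let ?D = "transpose_coderivation G \<delta>"
  have "?D h (us @ (v + w) # ws) = ?D h (us @ v # ws) + ?D h (us @ w # ws)
     \<and> ?D h (us @ scale c v # ws) = scaleW c (?D h (us @ v # ws))" for us v w ws c
    using assms
  proof (induction us arbitrary: h)
    case (Nil h)
    have "(\<lambda>ws. h (koszul G 1 (v + w) # ws)) = (\<lambda>ws. h (koszul G 1 v # ws) + h (koszul G 1 w # ws))"
      "(\<lambda>ws. h (koszul G 1 (scale c v) # ws)) = (\<lambda>ws. scaleW c (h (koszul G 1 v # ws)))"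
      by (simp_all add: koszul_add koszul_scale slotwise_linear_head[OF Nil])
    then show ?case
      by (simp add: derivation_add derivation_scale contract_add[OF Nil] contract_scale[OF Nil]
          transpose_coderivation_fun_add transpose_coderivation_fun_scale sum.distrib
          W.scale_right_distrib W.scale_sum_right)
  next
    case (Cons u us h)
    then show ?case
      using Cons.IH[OF slotwise_linear_Cons[OF Cons.prems, of "koszul G 1 u"]]
        slotwise_linear_contract[OF Cons.prems, unfolded slotwise_linear_def]
      by (simp add: sum.distrib W.scale_right_distrib W.scale_sum_right)
  qed
  then show ?thesis by (simp add: slotwise_linear_def)
qed

text \<open>
  The failure of the coderivation to commute with a contraction consists of the terms in which
  some \<open>\<delta>\<^sub>l\<close> hits the leading factor: those hitting a later factor of the product cancel by the
  Leibniz rule.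
\<close>

lemma contract_transpose_coderivation:
  assumes h: "slotwise_linear scale scaleW h"
  shows "contract k (transpose_coderivation G \<delta> h) b vs
       = transpose_coderivation G \<delta> (contract k h (koszul G 1 b)) vs
         + (\<Sum>l\<le>length vs. contract (k + l) h (\<delta> l b) vs)"
proof (induction k arbitrary: b vs)
  case 0
  have "contract 0 h (koszul G 1 b) = (\<lambda>ws. h (koszul G 1 b # ws))" by auto
  then show ?case by (simp add: add.commute)
next
  case (Suc k)
  show ?case
  proof (cases vs)
    case (Cons w ws)
    let ?D = "transpose_coderivation G \<delta>" and ?\<tau> = "koszul G 1"
    have "?D (contract (Suc k) h (?\<tau> b)) vs
        = (\<Sum>l\<le>length ws. contract (k + l) h (?\<tau> b * \<delta> l w) ws) + ?D (contract k h (?\<tau> (b * w))) ws"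
      by (simp add: Cons contract_contract koszul_mult)
    moreover have "(\<Sum>l\<le>length vs. contract (Suc k + l) h (\<delta> l b) vs)
        = (\<Sum>l\<le>length ws. contract (k + l) h (\<delta> l b * w) ws)"
    proof -
      \<comment> \<open>The term \<open>l = length vs\<close> asks for more letters than
        \<open>ws\<close> has, so it vanishes and the ranges agree.\<close>
      have "contract (k + Suc (length ws)) h c ws = 0" for c
        by (simp add: contract_eq)
      then show ?thesis by (simp add: Cons)
    qed
    moreover have "contract (Suc k) (?D h) b vs
        = ?D (contract k h (?\<tau> (b * w))) ws + (\<Sum>l\<le>length ws. contract (k + l) h (\<delta> l (b * w)) ws)"
      using Suc[of "b * w" ws] by (simp add: Cons)
    \<comment> \<open>The Leibniz rule splits \<open>\<delta> l (b * w)\<close>: the part hitting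
      \<open>w\<close> is the first sum of the first equation, the part hitting \<open>b\<close> is
      the second equation.\<close>
    ultimately show ?thesis
      by (simp add: derivation_mult contract_add[OF h] sum.distrib)
  qed simp
qed

text \<open>Induction on the word, sorting pairs of operations by whether they start at the first
  letter \<open>v\<close>. Pairs entirely behind \<open>v\<close> cancel by the induction
  hypothesis; for the others \<open>contract_transpose_coderivation\<close> leaves only terms in
  \<open>\<delta> l (\<delta> k v)\<close>.\<close>

theorem transpose_coderivation_square_zero:
  assumes "slotwise_linear scale scaleW h"
  shows "transpose_coderivation G \<delta> (transpose_coderivation G \<delta> h) vs = 0"
  using assms
proof (induction vs arbitrary: h)
  case (Cons v vs)
  note h = Cons.prems
  let ?D = "transpose_coderivation G \<delta>" and ?\<tau> = "koszul G 1" and ?N = "length vs"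
  have "?D (\<lambda>ws. ?D h (?\<tau> v # ws)) vs
      = ?D (\<lambda>ws. (\<Sum>k\<le>?N. contract k h (\<delta> k (?\<tau> v)) ws) + ?D (\<lambda>us. h (v # us)) ws) vs"
  \<comment> \<open>The range of \<open>k\<close> depends on the word \<open>ws\<close>. Fixing it
    at \<open>?N\<close> adds only vanishing contractions and lets the sum be pulled out of
    \<open>?D\<close>.\<close>
  proof (rule transpose_coderivation_cong)
    fix ws :: "'a list" assume "length ws \<le> ?N"
    then have "(\<Sum>k\<le>length ws. contract k h (\<delta> k (?\<tau> v)) ws) = (\<Sum>k\<le>?N. contract k h (\<delta> k (?\<tau> v)) ws)"
      by (intro sum.mono_neutral_left) (auto simp: contract_eq)
    then show "?D h (?\<tau> v # ws) = (\<Sum>k\<le>?N. contract k h (\<delta> k (?\<tau> v)) ws) + ?D (\<lambda>us. h (v # us)) ws"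
      by (simp add: koszul_koszul koszul_even)
  qed
  also have "\<dots> = (\<Sum>k\<le>?N. ?D (contract k h (\<delta> k (?\<tau> v))) vs)"
    using Cons.IH[OF slotwise_linear_Cons[OF h]]
    by (simp add: transpose_coderivation_fun_add transpose_coderivation_fun_sum)
  \<comment> \<open>Since \<open>\<delta> k\<close> is odd it anticommutes with
    \<open>?\<tau>\<close>. The resulting sign makes these terms cancel those in which the operation
    at \<open>v\<close> comes first.\<close>
  also have "\<dots> = - (\<Sum>k\<le>?N. ?D (contract k h (?\<tau> (\<delta> k v))) vs)"
  proof -
    have "contract k h (\<delta> k (?\<tau> v)) = (\<lambda>ws. - contract k h (?\<tau> (\<delta> k v)) ws)" for k
      by (rule ext) (simp add: koszul_derivation signed_def contract_uminus[OF h])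
    then show ?thesis
      by (simp add: transpose_coderivation_fun_uminus sum_negf)
  qed
  finally have "?D (?D h) (v # vs) = (\<Sum>k\<le>?N. \<Sum>l\<le>?N. contract (k + l) h (\<delta> l (\<delta> k v)) vs)"
    by (simp add: contract_transpose_coderivation[OF h] sum.distrib)
  also have "\<dots> = (\<Sum>l\<le>?N. \<Sum>k\<le>?N. contract (l + k) h (\<delta> l (\<delta> k v)) vs)"
    by (subst sum.swap) (simp add: add.commute)
  \<comment> \<open>Outside the triangle the contractions vanish. Regrouping by
    \<open>n = l + k\<close> then produces the coefficients of \<open>d d v\<close>.\<close>
  also have "\<dots> = (\<Sum>(l, k)\<in>{(l, k). l + k \<le> ?N}. contract (l + k) h (\<delta> l (\<delta> k v)) vs)"
    unfolding sum.cartesian_product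
    by (rule sum.mono_neutral_right) (auto simp: contract_eq split: if_splits)
  also have "\<dots> = (\<Sum>n\<le>?N. \<Sum>l\<le>n. contract n h (\<delta> l (\<delta> (n - l) v)) vs)"
    by (subst sum.triangle_reindex_eq) simp
  also have "\<dots> = 0"
    by (simp flip: contract_sum[OF h] add: square_zero contract_zero[OF h])
  finally show ?case .
qed simp

end

end

section \<open>The free vector space on words and its multilinearity relations\<close>

lemma lookup_words_scale [simp]:
  "Poly_Mapping.lookup (words_scale c x) w = c * Poly_Mapping.lookup x w"
  unfolding words_scale_def by transfer (simp add: when_def)

lemma vector_space_words: "vector_space (words_scale :: 'k::field \<Rightarrow> ('a, 'k) words \<Rightarrow> _)"
  by unfold_locales (rule poly_mapping_eqI, simp add: lookup_add algebra_simps)+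

interpretation words: vector_space "words_scale :: 'k::field \<Rightarrow> ('a, 'k) words \<Rightarrow> ('a, 'k) words"
  by (rule vector_space_words)

lemma linear_extension_superset:
  assumes "finite S" "Poly_Mapping.keys x \<subseteq> S"
  shows "linear_extension f x = (\<Sum>w\<in>S. words_scale (Poly_Mapping.lookup x w) (f w))"
  unfolding linear_extension_def
  by (rule sum.mono_neutral_left) (use assms in \<open>auto simp: in_keys_iff\<close>)

lemma linear_extension_add: "linear_extension f (x + y) = linear_extension f x + linear_extension f y"
proof -
  let ?S = "Poly_Mapping.keys x \<union> Poly_Mapping.keys y"
  have fin: "finite ?S" by simp
  have "linear_extension f (x + y) = (\<Sum>w\<in>?S. words_scale (Poly_Mapping.lookup (x + y) w) (f w))"
    by (rule linear_extension_superset[OF fin]) (rule Poly_Mapping.keys_add)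
  also have "\<dots> = linear_extension f x + linear_extension f y"
    by (simp add: linear_extension_superset[OF fin] lookup_add words.scale_left_distrib sum.distrib)
  finally show ?thesis .
qed

lemma linear_extension_scale: "linear_extension f (words_scale c x) = words_scale c (linear_extension f x)"
proof -
  have "linear_extension f (words_scale c x)
      = (\<Sum>w\<in>Poly_Mapping.keys x. words_scale (Poly_Mapping.lookup (words_scale c x) w) (f w))"
    by (rule linear_extension_superset) (auto simp: in_keys_iff)
  then show ?thesis
    by (simp add: linear_extension_def words.scale_sum_right)
qed

lemma linear_linear_extension:
  "Vector_Spaces.linear words_scale words_scale (linear_extension f)"
  by (simp add: Vector_Spaces.linear_iff vector_space_words linear_extension_add linear_extension_scale)

lemma linear_extension_word [simp]: "linear_extension f (word vs) = f vs"
  by (simp add: linear_extension_def word_def)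

lemma linear_extension_zero [simp]: "linear_extension f 0 = 0"
  by (simp add: linear_extension_def)

lemma linear_extension_const_zero: "linear_extension (\<lambda>_. 0) x = 0"
  by (simp add: linear_extension_def)

lemma linear_extension_sum: "linear_extension f (sum g S) = (\<Sum>i\<in>S. linear_extension f (g i))"
  by (induction S rule: infinite_finite_induct) (simp_all add: linear_extension_add)

lemma linear_extension_word_id: "linear_extension word x = x"
proof (rule poly_mapping_eqI)
  fix w
  have "Poly_Mapping.lookup (linear_extension word x) w
      = (\<Sum>v\<in>Poly_Mapping.keys x. if v = w then Poly_Mapping.lookup x w else 0)"
    unfolding linear_extension_def lookup_sum
    by (rule sum.cong) (auto simp: word_def lookup_single when_def)
  then show "Poly_Mapping.lookup (linear_extension word x) w = Poly_Mapping.lookup x w"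
    by (simp add: in_keys_iff)
qed

lemma linear_extension_compose:
  assumes "Vector_Spaces.linear words_scale words_scale g"
  shows "g (linear_extension f x) = linear_extension (\<lambda>w. g (f w)) x"
proof -
  interpret Vector_Spaces.linear words_scale words_scale g by fact
  show ?thesis by (simp add: linear_extension_def sum scale)
qed

lemma subspace_tensor_relations: "words.subspace (tensor_relations scale)"
  unfolding tensor_relations_def by (rule words.subspace_span)

lemma add_relation:
  "word (us @ (a + b) # ws) - word (us @ a # ws) - word (us @ b # ws) \<in> tensor_relations scale"
  unfolding tensor_relations_def by (rule words.span_base) blast

lemma scale_relation:
  "word (us @ scale c a # ws) - words_scale c (word (us @ a # ws)) \<in> tensor_relations scale"
  unfolding tensor_relations_def by (rule words.span_base) blast

text \<open>Slotwise linearity says that the generating relations lie in the kernel of the linear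
  extension, which is a subspace. Such functions thus descend to the tensor space.\<close>

lemma linear_extension_tensor_relations:
  assumes h: "slotwise_linear scale words_scale h" and x: "x \<in> tensor_relations scale"
  shows "linear_extension h x = 0"
proof -
  interpret L: Vector_Spaces.linear words_scale words_scale "linear_extension h"
    by (rule linear_linear_extension)
  have "x \<in> {x. linear_extension h x = 0}"
    using x unfolding tensor_relations_def
    by (rule set_mp[OF words.span_minimal, rotated 2])
      (use h in \<open>auto simp: L.diff linear_extension_scale slotwise_linear_def L.subspace_kernel\<close>)
  then show ?thesis by simp
qed

text \<open>
  \<open>h\<close> sends a word to its difference with its projection onto the relations.
\<close>

lemma tensor_relations_kernel:
  obtains h :: "'a::ab_group_add list \<Rightarrow> ('a, 'k::field) words"
  where "slotwise_linear scale words_scale h"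
    and "\<And>x. x \<in> tensor_relations scale \<longleftrightarrow> linear_extension h x = 0"
proof -
  interpret P: vector_space_pair "words_scale :: 'k \<Rightarrow> ('a, 'k) words \<Rightarrow> _"
      "words_scale :: 'k \<Rightarrow> ('a, 'k) words \<Rightarrow> _"
    by unfold_locales
  let ?R = "tensor_relations scale :: ('a, 'k) words set"
  \<comment> \<open>A linear projection onto the relations, obtained as a left inverse of the
    identity on that subspace.\<close>
  obtain g where g: "range g \<subseteq> ?R" "Vector_Spaces.linear words_scale words_scale g"
      "\<forall>x\<in>?R. g x = x"
    using P.linear_exists_left_inverse_on[OF words.linear_id subspace_tensor_relations[of scale]] by auto
  define h where "h w = word w - g (word w)" for w
  have h: "linear_extension h x = x - g x" for x
  proof -
    have "Vector_Spaces.linear words_scale words_scale (\<lambda>y. y - g y)"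
      using g(2) by (simp add: Vector_Spaces.linear_iff words.scale_right_diff_distrib)
    from linear_extension_compose[OF this, of word x] show ?thesis
      by (simp add: h_def[abs_def] linear_extension_word_id)
  qed
  have kernel: "x \<in> ?R \<longleftrightarrow> linear_extension h x = 0" for x
    using g(1,3) by (auto simp: h)
  interpret L: Vector_Spaces.linear words_scale words_scale "linear_extension h"
    by (rule linear_linear_extension)
  \<comment> \<open>Slotwise linearity is read off from the kernel, since it contains the generating
    relations.\<close>
  have "slotwise_linear scale words_scale h"
    unfolding slotwise_linear_def
  proof (intro conjI allI)
    fix us ws :: "'a list" and a b c
    show "h (us @ (a + b) # ws) = h (us @ a # ws) + h (us @ b # ws)"
      using add_relation[of us a b ws scale] by (simp add: kernel L.diff linear_extension_add algebra_simps)
    show "h (us @ scale c a # ws) = words_scale c (h (us @ a # ws))"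
      using scale_relation[of us scale c a ws] by (simp add: kernel L.diff linear_extension_scale)
  qed
  then show ?thesis using kernel that by blast
qed

lemma tensor_class_eqI:
  assumes "x - y \<in> tensor_relations scale"
  shows "tensor_class scale x = tensor_class scale y"
proof -
  have "x - z \<in> tensor_relations scale \<longleftrightarrow> y - z \<in> tensor_relations scale" for z
    using words.subspace_diff[OF subspace_tensor_relations _ assms, of "x - z"]
      words.subspace_add[OF subspace_tensor_relations _ assms, of "y - z"]
    by auto
  then show ?thesis by (auto simp: tensor_class_def tensor_eq_def)
qed

text \<open>All representatives of the class have images in one class, so the union defining
  \<open>induced_map\<close> collapses to it.\<close>

lemma induced_map_tensor_class:
  assumes "\<And>y. y \<in> tensor_relations scale \<Longrightarrow> linear_extension f y \<in> tensor_relations scale"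
  shows "induced_map scale f (tensor_class scale x) = tensor_class scale (linear_extension f x)"
proof -
  interpret L: Vector_Spaces.linear words_scale words_scale "linear_extension f"
    by (rule linear_linear_extension)
  have "tensor_class scale (linear_extension f y) = tensor_class scale (linear_extension f x)"
    if "y \<in> tensor_class scale x" for y
    by (rule tensor_class_eqI[symmetric])
      (use assms[of "x - y"] that in \<open>simp add: tensor_class_def tensor_eq_def L.diff\<close>)
  moreover have "x \<in> tensor_class scale x"
    by (simp add: tensor_class_def tensor_eq_def words.subspace_0[OF subspace_tensor_relations])
  ultimately show ?thesis unfolding induced_map_def by blast
qed

section \<open>The total coderivation and its transpose\<close>

lemma linear_extension_coderivation:
  "linear_extension h (coderivation G p i f vs) =
    (if length vs < i then 0
     else \<Sum>k = 0..length vs - i. h (map (koszul G p) (take k vs) @ f (take i (drop k vs)) # drop (k + i) vs))"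
  by (simp add: coderivation_def linear_extension_sum)

text \<open>The summand \<open>k = 0\<close> applies \<open>f\<close> at the front. The others keep
  \<open>v\<close> up to its sign and, after a shift of \<open>k\<close>, form the coderivation on
  \<open>vs\<close>.\<close>

lemma linear_extension_coderivation_Cons:
  assumes "i \<le> Suc (length vs)"
  shows "linear_extension h (coderivation G p i f (v # vs)) =
    h (f (take i (v # vs)) # drop i (v # vs))
    + linear_extension (\<lambda>ws. h (koszul G p v # ws)) (coderivation G p i f vs)"
proof (cases "i = Suc (length vs)")
  case True
  then show ?thesis by (simp add: linear_extension_coderivation)
next
  case False
  then have "Suc (length vs) - i = Suc (length vs - i)" "i \<le> length vs" using assms by auto
  then show ?thesis
    by (simp add: linear_extension_coderivation sum.atLeast0_atMost_Suc_shift del: sum.cl_ivl_Suc)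
qed

text \<open>Splitting every coderivation at the first letter reproduces the recursion of
  \<open>transpose_coderivation\<close>; this links the dual calculation to the actual
  coderivation.\<close>

lemma linear_extension_total_coderivation:
  assumes f: "\<And>v vs. desuspension G m (Suc (length vs)) (v # vs) = foldl (*) (\<delta> (length vs) v) vs"
  shows "linear_extension h (total_coderivation G m vs) = transpose_coderivation G \<delta> h vs"
proof (induction vs arbitrary: h)
  case (Cons v vs)
  let ?C = "\<lambda>i. coderivation G 1 i (desuspension G m i)" and ?h = "\<lambda>ws. h (koszul G 1 v # ws)"
  have *: "linear_extension h (?C (Suc k) (v # vs))
      = contract k h (\<delta> k v) vs + linear_extension ?h (?C (Suc k) vs)" if "k \<le> length vs" for k
    using that f[of "take k vs" v]
    by (simp add: linear_extension_coderivation_Cons contract_eq min_absorb2)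
  have "linear_extension h (total_coderivation G m (v # vs))
      = (\<Sum>k = 0..length vs. linear_extension h (?C (Suc k) (v # vs)))"
    by (simp add: total_coderivation_def linear_extension_sum sum.shift_bounds_cl_Suc_ivl
        del: sum.cl_ivl_Suc)
  also have "\<dots> = (\<Sum>k\<le>length vs. contract k h (\<delta> k v) vs)
      + (\<Sum>k = 0..length vs. linear_extension ?h (?C (Suc k) vs))"
    by (simp add: * sum.distrib atLeast0AtMost cong: sum.cong_simp)
  also have "(\<Sum>k = 0..length vs. linear_extension ?h (?C (Suc k) vs))
      = linear_extension ?h (total_coderivation G m vs)"
  \<comment> \<open>The index \<open>i = Suc (length vs)\<close> exceeds the length of
    \<open>vs\<close>, so its coderivation is zero there.\<close>
  proof -
    have "(\<Sum>k = 0..length vs. linear_extension ?h (?C (Suc k) vs))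
        = (\<Sum>i = 1..Suc (length vs). linear_extension ?h (?C i vs))"
      by (simp add: sum.shift_bounds_cl_Suc_ivl del: sum.cl_ivl_Suc)
    then show ?thesis
      by (simp add: total_coderivation_def linear_extension_sum linear_extension_coderivation)
  qed
  finally show ?case by (simp add: Cons.IH)
qed (simp add: total_coderivation_def)

section \<open>Signs and degrees of the higher derived products\<close>

lemma foldl_mult_signed: "foldl (*) (signed n a) xs = signed n (foldl (*) a xs)" for a :: "'a::ring"
  by (induction xs arbitrary: a) (simp_all add: signed_mult_left)

lemma signed_cong: "even (m - n) \<Longrightarrow> signed m a = signed n a"
  by (simp add: signed_def)

lemma length_tensor_maps: "length (tensor_maps G fs xs) = min (length fs) (length xs)"
  by (induction G fs xs rule: tensor_maps.induct) auto

lemma tensor_maps_id: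
  assumes "graded_vector_space scale G"
  shows "length xs = n \<Longrightarrow> tensor_maps G (replicate n (id, 0)) xs = xs"
proof (induction xs arbitrary: n)
  case (Cons x xs)
  interpret graded_vector_space scale G by fact
  from Cons show ?case by (cases n) (simp_all add: koszul_even sum_list_replicate)
qed simp

context deformed_algebra
begin

lemma foldl_mult_add: "foldl (*) (a + b :: 'a) xs = foldl (*) a xs + foldl (*) b xs"
  by (induction xs arbitrary: a b) (simp_all add: distrib_right)

lemma foldl_mult_scale: "foldl (*) (scale c a) xs = scale c (foldl (*) a xs)"
  by (induction xs arbitrary: a) (simp_all add: scale_mult_left)

lemma unsusp_koszul_susp:
  "unsusp (koszul (susp_grading G) p x) = signed p (koszul G p (unsusp x))"
  by (rule koszul_susp) unfold_locales

text \<open>Meant for the arguments after the first: the sign on each entry depends only on the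
  number of letters to its right, so the tail can be desuspended separately.\<close>

definition unsusps :: "'a susp list \<Rightarrow> 'a list"
  where "unsusps xs = tensor_maps (susp_grading G) (replicate (length xs) (unsusp, -1)) xs"

text \<open>Each pair of positions contributes one sign, from moving an \<open>s^-1\<close> past an
  \<open>s\<close>; there are \<open>n (n - 1) / 2\<close> pairs.\<close>

lemma foldl_mult_unsusps_susps:
  "length vs = n \<Longrightarrow>
   foldl (*) a (tensor_maps (susp_grading G) (replicate n (unsusp, -1))
     (tensor_maps G (replicate n (Susp, 1)) vs)) = signed (int n * (int n - 1) div 2) (foldl (*) a vs)"
proof (induction vs arbitrary: a n)
  case (Cons v vs)
  then obtain l where n: "n = Suc l" "length vs = l" by auto
  have "(int l + 1) * int l = int l * (int l - 1) + int l * 2" by (simp add: algebra_simps)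
  then have "(int l + 1) * int l div 2 = int l * (int l - 1) div 2 + int l" by simp
  \<comment> \<open>The first letter contributes \<open>- l\<close> where the formula has
    \<open>+ l\<close>; the parities agree.\<close>
  then have "signed (int l * (int l - 1) div 2 - int l) x = signed ((int l + 1) * int l div 2) x" for x :: 'a
    by (intro signed_cong) simp
  with n Cons.IH[OF n(2)] show ?case
    by (simp add: sum_list_replicate unsusp_koszul_susp koszul_koszul koszul_even signed_mult_right
        foldl_mult_signed algebra_simps)
qed simp

text \<open>For \<open>n = length xs\<close>, the exponent \<open>n (n - 1) / 2\<close> is the
  prefactor at \<open>i = n + 1\<close>. The extra \<open>- n\<close> comes from moving
  \<open>n\<close> copies of \<open>s^-1\<close> past the \<open>s\<close> on the first
  argument.\<close>

lemma unsusp_higher_derived_product: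
  "unsusp (higher_derived_product G \<delta> (Suc (length xs)) (x # xs)) =
    signed (int (length xs) * (int (length xs) - 1) div 2 - int (length xs))
      (foldl (*) (koszul G (- int (length xs)) (\<delta> (length xs) (unsusp x))) (unsusps xs))"
proof -
  have S: "graded_vector_space (susp_scale scale) (susp_grading G)"
    by (rule graded_vector_space_susp) unfold_locales
  show ?thesis
    by (simp add: higher_derived_product_def unsusps_def tensor_maps_id[OF S] sum_list_replicate
        unsusp_koszul_susp koszul_even foldl_mult_signed graded_vector_space.koszul_even[OF S])
qed

text \<open>The exponent \<open>n (n - 1) / 2\<close> occurs twice, in the prefactor and in the
  desuspended tail. So does \<open>- n\<close>, from the \<open>s\<close> on the first argument and
  from moving the Koszul sign past \<open>\<delta> n\<close>. The total is even.\<close>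

lemma desuspension_higher_derived_product:
  "desuspension G (higher_derived_product G \<delta>) (Suc (length vs)) (v # vs) = foldl (*) (\<delta> (length vs) v) vs"
proof -
  let ?n = "length vs"
  let ?xs = "tensor_maps G (replicate ?n (Susp, 1)) vs"
  let ?x = "Susp (koszul G (int ?n) v)"
  have len: "length ?xs = ?n" by (simp add: length_tensor_maps)
  have "desuspension G (higher_derived_product G \<delta>) (Suc ?n) (v # vs)
      = unsusp (higher_derived_product G \<delta> (Suc (length ?xs)) (?x # ?xs))"
    by (simp add: desuspension_def sum_list_replicate len)
  also have "\<dots> = foldl (*) (\<delta> ?n v) vs"
    using unsusp_higher_derived_product[of ?xs ?x, unfolded unsusps_def len]
    by (simp add: len foldl_mult_unsusps_susps koszul_derivation koszul_koszul koszul_even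
        foldl_mult_signed signed_even)
  finally show ?thesis .
qed

lemma unsusps_in_G:
  "a \<in> G p \<Longrightarrow> list_all2 (\<lambda>x d. x \<in> susp_grading G d) xs ds \<Longrightarrow>
   foldl (*) a (unsusps xs) \<in> G (p + sum_list ds - int (length xs))"
proof (induction xs arbitrary: a p ds)
  case (Cons x xs)
  then obtain d es where ds: "ds = d # es" "x \<in> susp_grading G d"
      "list_all2 (\<lambda>x d. x \<in> susp_grading G d) xs es"
    by (auto simp: list_all2_Cons1)
  have "a * unsusp (koszul (susp_grading G) (- int (length xs)) x) \<in> G (p + (d - 1))"
    using ds(2) Cons.prems(1)
    by (intro mult_degree) (simp_all add: unsusp_koszul_susp signed_in_G koszul_in_G in_susp_grading_iff)
  from Cons.IH[OF this ds(3)] show ?case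
    by (simp add: ds(1) unsusps_def sum_list_replicate algebra_simps)
qed (simp add: unsusps_def)

text \<open>The other entries do not depend on \<open>v\<close>, which isolates the slot whose
  linearity is to be shown.\<close>

lemma unsusps_append:
  "\<exists>as bs. \<forall>v. unsusps (us @ v # ws) = as @ unsusp (koszul (susp_grading G) (- int (length ws)) v) # bs"
proof (induction us)
  case Nil
  show ?case by (rule exI[of _ "[]"]) (simp add: unsusps_def sum_list_replicate)
next
  case (Cons u us)
  then obtain as bs
    where "\<And>v. unsusps (us @ v # ws) = as @ unsusp (koszul (susp_grading G) (- int (length ws)) v) # bs"
    by blast
  then show ?case
    by (intro exI[of _ "unsusp (koszul (susp_grading G) (- int (length us + length ws + 1)) u) # as"] exI[of _ bs])
      (simp add: unsusps_def sum_list_replicate)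
qed

lemma higher_derived_product_multilinear_of_degree:
  assumes "i \<ge> 1"
  shows "multilinear_of_degree (susp_scale scale) (susp_grading G)
    (susp_scale scale) (susp_grading G) i (2 - int i) (higher_derived_product G \<delta> i)"
  unfolding multilinear_of_degree_def multilinear_def
proof (intro conjI allI impI)
  fix us ws :: "'a susp list" assume i: "length us + 1 + length ws = i"
  let ?m = "higher_derived_product G \<delta> i"
  have "unsusp (?m (us @ (x + y) # ws)) = unsusp (?m (us @ x # ws)) + unsusp (?m (us @ y # ws)) \<and>
      unsusp (?m (us @ susp_scale scale c x # ws)) = scale c (unsusp (?m (us @ x # ws)))" for x y c
  \<comment> \<open>In the first slot linearity comes from that of the derivation, in a later slot
    from bilinearity of the product.\<close>
  proof (cases us)
    case Nil
    have "i = Suc (length ws)" using i Nil by simp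
    then show ?thesis
      by (simp add: Nil unsusp_higher_derived_product derivation_add derivation_scale koszul_add
          koszul_scale foldl_mult_add foldl_mult_scale signed_add signed_scale)
  next
    case (Cons u us')
    obtain as bs where unsusps: "\<And>v. unsusps (us' @ v # ws)
        = as @ unsusp (koszul (susp_grading G) (- int (length ws)) v) # bs"
      using unsusps_append by blast
    have "unsusp (?m (u # us' @ v # ws)) =
        signed (int (i - 1) * (int (i - 1) - 1) div 2 - int (i - 1))
          (foldl (*) (koszul G (- int (i - 1)) (\<delta> (i - 1) (unsusp u))) (unsusps (us' @ v # ws)))" for v
    proof -
      have "i = Suc (length (us' @ v # ws))" using i Cons by simp
      then show ?thesis
        using unsusp_higher_derived_product[of "us' @ v # ws" u] by (metis diff_Suc_1)
    qed
    then show ?thesis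
      by (simp add: Cons unsusps unsusp_koszul_susp koszul_add koszul_scale signed_add signed_scale
          distrib_left scale_mult_right foldl_mult_add foldl_mult_scale)
  qed
  then show "Vector_Spaces.linear (susp_scale scale) (susp_scale scale) (\<lambda>v. ?m (us @ v # ws))"
    by (auto simp: Vector_Spaces.linear_iff vector_space_susp vector_space_axioms intro: susp.expand)
next
  fix xs :: "'a susp list" and ds
  assume *: "length xs = i \<and> list_all2 (\<lambda>x d. x \<in> susp_grading G d) xs ds"
  with assms obtain y ys where xs: "xs = y # ys" "i = Suc (length ys)"
    by (cases xs) auto
  with * obtain d es where ds: "ds = d # es" "y \<in> susp_grading G d"
      "list_all2 (\<lambda>x d. x \<in> susp_grading G d) ys es"
    by (auto simp: list_all2_Cons1)
  \<comment> \<open>Unsuspending \<open>y\<close> lowers its degree to \<open>d - 1\<close> and the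
    derivation restores \<open>d\<close>. The other \<open>i - 1\<close> factors lose one degree
    each and the final suspension adds one, which gives \<open>2 - i\<close>.\<close>
  have "koszul G (- int (length ys)) (\<delta> (length ys) (unsusp y)) \<in> G d"
    using derivation_in_G[of "unsusp y" "d - 1"] ds(2) by (simp add: in_susp_grading_iff koszul_in_G)
  from unsusps_in_G[OF this ds(3)]
  show "higher_derived_product G \<delta> i xs \<in> susp_grading G (sum_list ds + (2 - int i))"
    by (simp add: xs ds(1) in_susp_grading_iff unsusp_higher_derived_product signed_in_G algebra_simps)
qed

text \<open>One slotwise linear \<open>h\<close> detects membership in the relations, so both
  well-definedness on classes and the vanishing of the square are tested by applying
  \<open>h\<close> and passing to the transpose.\<close>

theorem sh_associative_algebra_higher_derived_product:
  "sh_associative_algebra scale G (higher_derived_product G \<delta>)"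
  unfolding sh_associative_algebra_def
proof (intro conjI allI impI ballI)
  show "graded_vector_space scale G" by unfold_locales
next
  fix i :: nat assume "i \<ge> 1"
  then show "multilinear_of_degree (susp_scale scale) (susp_grading G)
      (susp_scale scale) (susp_grading G) i (2 - int i) (higher_derived_product G \<delta> i)"
    by (rule higher_derived_product_multilinear_of_degree)
next
  fix X assume "X \<in> reduced_tensor_space scale"
  then obtain x where X: "X = tensor_class scale x" by (auto simp: reduced_tensor_space_def)
  let ?d = "total_coderivation G (higher_derived_product G \<delta>) :: 'a list \<Rightarrow> ('a, 'k) words"
  obtain h :: "'a list \<Rightarrow> ('a, 'k) words" where h: "slotwise_linear scale words_scale h"
    and kernel: "\<And>x. x \<in> tensor_relations scale \<longleftrightarrow> linear_extension h x = 0"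
    using tensor_relations_kernel[of scale] by blast
  have transpose: "linear_extension k (linear_extension ?d y) = linear_extension (transpose_coderivation G \<delta> k) y"
    for k :: "'a list \<Rightarrow> ('a, 'k) words" and y
    by (simp add: linear_extension_compose[OF linear_linear_extension]
        linear_extension_total_coderivation[OF desuspension_higher_derived_product])
  \<comment> \<open>The transpose of \<open>h\<close> is again slotwise linear and hence kills the
    relations.\<close>
  have closed: "linear_extension ?d y \<in> tensor_relations scale" if "y \<in> tensor_relations scale" for y
    unfolding kernel transpose
    using slotwise_linear_transpose_coderivation[OF vector_space_words h] that
    by (rule linear_extension_tensor_relations)
  have induced: "induced_map scale ?d (tensor_class scale y) = tensor_class scale (linear_extension ?d y)" for y
    by (rule induced_map_tensor_class) (rule closed)
  have "transpose_coderivation G \<delta> (transpose_coderivation G \<delta> h) = (\<lambda>_. 0)"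
    by (rule ext) (rule transpose_coderivation_square_zero[OF vector_space_words h])
  then have "linear_extension ?d (linear_extension ?d x) \<in> tensor_relations scale"
    by (simp add: kernel transpose[of h] transpose[of "transpose_coderivation G \<delta> h"] linear_extension_const_zero)
  then show "induced_map scale ?d (induced_map scale ?d X) = tensor_class scale 0"
    unfolding X induced by (intro tensor_class_eqI) simp
qed

end

theorem theorem3p1:
  fixes scale :: "'k::field_char_0 \<Rightarrow> 'a::ring \<Rightarrow> 'a"
    and G :: "int \<Rightarrow> 'a set"
    and \<delta>\<^sub>0 :: "'a \<Rightarrow> 'a"
    and \<delta> :: "nat \<Rightarrow> 'a \<Rightarrow> 'a"
  assumes "dg_algebra scale G \<delta>\<^sub>0"
    and "formal_deformation scale G \<delta>\<^sub>0 \<delta>"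
  shows "sh_associative_algebra scale G (higher_derived_product G \<delta>)"
proof -
  interpret graded_algebra scale G
    using assms(1) by (simp add: dg_algebra_def)
  have derivation: "derivation_of_degree scale G 1 (\<delta> i)" for i
    using assms(2) by (simp add: formal_deformation_def)
  have zero: "\<delta> i 0 = 0" for i
  proof -
    have "\<delta> i (0 + 0) = \<delta> i 0 + \<delta> i 0"
      using derivation[of i] unfolding derivation_of_degree_def Vector_Spaces.linear_iff by blast
    then show ?thesis by simp
  qed
  have "(\<Sum>i\<le>n. \<delta> i (\<delta> (n - i) a)) = 0" for n a
  proof -
    \<comment> \<open>On the constant series \<open>a\<close> only \<open>i = n\<close> survives, so
      \<open>d a\<close> has coefficients \<open>\<delta> n a\<close>. The coefficient of
      \<open>t^n\<close> in \<open>d d a\<close> is then the required sum.\<close>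
    have "(\<Sum>i\<le>n. \<delta> i (if n - i = 0 then a else 0)) = (\<Sum>i\<le>n. if i = n then \<delta> n a else 0)" for n
      by (rule sum.cong) (auto simp: zero)
    then have "series_map \<delta> (fps_const a) = Abs_fps (\<lambda>n. \<delta> n a)"
      by (simp add: series_map_def)
    then have "series_map \<delta> (Abs_fps (\<lambda>n. \<delta> n a)) = 0"
      using assms(2) by (metis formal_deformation_def)
    then have "fps_nth (series_map \<delta> (Abs_fps (\<lambda>n. \<delta> n a))) n = 0" by simp
    then show ?thesis by (simp add: series_map_def)
  qed
  with derivation interpret deformed_algebra scale G \<delta>
    by unfold_locales auto
  show ?thesis by (rule sh_associative_algebra_higher_derived_product)
qed

end
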